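(* There is a comeager subset of $\mathcal C(\{0,1\}^{\mathbb N})$, no element of which has a Li-Yorke pair.
   Context: $\{0,1\}^{\mathbb N}$ ($\mathbb N$ the positive integers) has the product topology and the metric $d(\sigma,\tau)=1/n$, where $n$ is the least positive integer with $\sigma(n)\neq\tau(n)$, and $d(\sigma,\sigma)=0$. $\mathcal C(\{0,1\}^{\mathbb N})$ is the space of all continuous self-maps of $\{0,1\}^{\mathbb N}$ with the metric $\tilde d(f,g)=\max_\sigma d(f(\sigma),g(\sigma))$. A pair $(x,y)$ is a Li-Yorke pair for a map $f$ if $\liminf_{n\to\infty}d(f^n(x),f^n(y))=0$ and $\limsup_{n\to\infty}d(f^n(x),f^n(y))>0$. *)

theory Defs
  imports "HOL-Analysis.Analysis"
begin

text \<open>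
  Points of Cantor space are functions \<open>nat \<Rightarrow> bool\<close>, with the library's product topology.
  The index set of the mathematics is the positive integers, so index \<open>k\<close> here is coordinate
  \<open>k + 1\<close> there; hence the \<open>Suc\<close> in the metric.
\<close>

type_synonym cantor = "nat \<Rightarrow> bool"

definition cantor_dist :: "cantor \<Rightarrow> cantor \<Rightarrow> real" where
  "cantor_dist \<sigma> \<tau> = (if \<sigma> = \<tau> then 0 else 1 / real (Suc (LEAST k. \<sigma> k \<noteq> \<tau> k)))"

definition cantor_metric :: "cantor metric" where
  "cantor_metric = metric (UNIV, cantor_dist)"

text \<open>The distance in \<open>cfunspace\<close> is the supremum of the pointwise distances; here
  it is a maximum, see \<open>mdist_cantor_maps_attained\<close> and \<open>mdist_cantor_maps_upper\<close> below.\<close>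

definition cantor_maps :: "(cantor \<Rightarrow> cantor) metric" where
  "cantor_maps = cfunspace euclidean cantor_metric"

definition nowhere_dense_in :: "'a topology \<Rightarrow> 'a set \<Rightarrow> bool" where
  "nowhere_dense_in X A \<longleftrightarrow> A \<subseteq> topspace X \<and> X interior_of (X closure_of A) = {}"

definition meager_in :: "'a topology \<Rightarrow> 'a set \<Rightarrow> bool" where
  "meager_in X A \<longleftrightarrow> (\<exists>\<N>. countable \<N> \<and> (\<forall>N\<in>\<N>. nowhere_dense_in X N) \<and> A = \<Union>\<N>)"

definition comeager_in :: "'a topology \<Rightarrow> 'a set \<Rightarrow> bool" where
  "comeager_in X A \<longleftrightarrow> A \<subseteq> topspace X \<and> meager_in X (topspace X - A)"

text \<open>The lower and upper limits are taken in the extended reals, a complete lattice.\<close>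

definition Li_Yorke_pair :: "'a metric \<Rightarrow> ('a \<Rightarrow> 'a) \<Rightarrow> 'a \<Rightarrow> 'a \<Rightarrow> bool" where
  "Li_Yorke_pair m f x y \<longleftrightarrow>
     liminf (\<lambda>n. ereal (mdist m ((f ^^ n) x) ((f ^^ n) y))) = 0 \<and>
     limsup (\<lambda>n. ereal (mdist m ((f ^^ n) x) ((f ^^ n) y))) > 0"


lemma cantor_dist_le_iff:
  "cantor_dist \<sigma> \<tau> \<le> 1 / real (Suc n) \<longleftrightarrow> (\<forall>k<n. \<sigma> k = \<tau> k)"
proof (cases "\<sigma> = \<tau>")
  case False
  then have ex: "\<exists>k. \<sigma> k \<noteq> \<tau> k" by auto
  define m where "m = (LEAST k. \<sigma> k \<noteq> \<tau> k)"
  have m: "\<sigma> m \<noteq> \<tau> m" unfolding m_def using ex by (rule LeastI_ex)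
  have less: "\<sigma> k = \<tau> k" if "k < m" for k
    using not_less_Least that unfolding m_def by blast
  have "cantor_dist \<sigma> \<tau> \<le> 1 / real (Suc n) \<longleftrightarrow> n \<le> m"
    using False unfolding cantor_dist_def m_def[symmetric] by (simp add: field_simps)
  also have "\<dots> \<longleftrightarrow> (\<forall>k<n. \<sigma> k = \<tau> k)"
    using m less by (meson leI less_le_trans)
  finally show ?thesis .
qed (simp add: cantor_dist_def)

lemma Metric_space_cantor_dist: "Metric_space UNIV cantor_dist"
proof
  fix \<sigma> \<tau> \<upsilon> :: cantor
  show "0 \<le> cantor_dist \<sigma> \<tau>" by (simp add: cantor_dist_def)
  show "cantor_dist \<sigma> \<tau> = cantor_dist \<tau> \<sigma>" by (simp add: cantor_dist_def eq_commute)
  show "cantor_dist \<sigma> \<tau> = 0 \<longleftrightarrow> \<sigma> = \<tau>" by (simp add: cantor_dist_def)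
  show "cantor_dist \<sigma> \<upsilon> \<le> cantor_dist \<sigma> \<tau> + cantor_dist \<tau> \<upsilon>"
  proof (cases "\<sigma> = \<tau> \<or> \<tau> = \<upsilon>")
    case True
    then show ?thesis by (auto simp: cantor_dist_def)
  next
    case False
    then obtain a b where a: "cantor_dist \<sigma> \<tau> = 1 / real (Suc a)"
      and b: "cantor_dist \<tau> \<upsilon> = 1 / real (Suc b)"
      unfolding cantor_dist_def by auto
    have "\<forall>k<a. \<sigma> k = \<tau> k" "\<forall>k<b. \<tau> k = \<upsilon> k"
      using a b by (simp_all only: cantor_dist_le_iff[symmetric])
    then have "\<forall>k<min a b. \<sigma> k = \<upsilon> k" by simp
    then have "cantor_dist \<sigma> \<upsilon> \<le> 1 / real (Suc (min a b))"
      by (simp only: cantor_dist_le_iff)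
    also have "\<dots> \<le> cantor_dist \<sigma> \<tau> + cantor_dist \<tau> \<upsilon>"
      unfolding a b by (simp add: min_def)
    finally show ?thesis .
  qed
qed

lemma mspace_cantor_metric [simp]: "mspace cantor_metric = UNIV"
  and mdist_cantor_metric [simp]: "mdist cantor_metric = cantor_dist"
  by (simp_all add: cantor_metric_def Metric_space.mspace_metric Metric_space.mdist_metric
      Metric_space_cantor_dist)

lemma mtopology_cantor_metric [simp]: "mtopology_of cantor_metric = euclidean"
proof -
  interpret Metric_space UNIV cantor_dist by (rule Metric_space_cantor_dist)
  have 1: "open (mball \<sigma> r)" for \<sigma> r
  proof (rule topological_space_class.openI)
    fix \<tau> assume "\<tau> \<in> mball \<sigma> r"
    then have "0 < r - cantor_dist \<sigma> \<tau>" by simp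
    then obtain n where n: "1 / real (Suc n) < r - cantor_dist \<sigma> \<tau>"
      using reals_Archimedean[of "r - cantor_dist \<sigma> \<tau>"] unfolding inverse_eq_divide by blast
    have "open {f. \<forall>k\<in>{..<n}. f (id k) \<in> {\<tau> k}}"
      by (rule product_topology_basis') (auto simp: open_discrete)
    moreover have "{f. \<forall>k\<in>{..<n}. f (id k) \<in> {\<tau> k}} \<subseteq> mball \<sigma> r"
    proof
      fix f assume "f \<in> {f. \<forall>k\<in>{..<n}. f (id k) \<in> {\<tau> k}}"
      then have "cantor_dist \<tau> f \<le> 1 / real (Suc n)"
        unfolding cantor_dist_le_iff by auto
      then show "f \<in> mball \<sigma> r"
        using n triangle[of \<sigma> \<tau> f] by simp
    qed
    ultimately show "\<exists>T. open T \<and> \<tau> \<in> T \<and> T \<subseteq> mball \<sigma> r"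
      by (intro exI[of _ "{f. \<forall>k\<in>{..<n}. f (id k) \<in> {\<tau> k}}"]) auto
  qed
  have 2: "\<exists>r>0. mball \<sigma> r \<subseteq> U" if U: "open U" "\<sigma> \<in> U" for \<sigma> :: cantor and U
  proof -
    have op: "openin (product_topology (\<lambda>i. euclidean) UNIV) U"
      using U(1) by (simp add: open_fun_def)
    obtain V where V: "finite {i. V i \<noteq> (UNIV :: bool set)}" "\<sigma> \<in> Pi\<^sub>E UNIV V" "Pi\<^sub>E UNIV V \<subseteq> U"
      using product_topology_open_contains_basis[OF op U(2)] by auto
    obtain n where n: "\<And>i. V i \<noteq> UNIV \<Longrightarrow> i < n"
      using V(1) unfolding finite_nat_set_iff_bounded by blast
    have "mball \<sigma> (1 / real (Suc n)) \<subseteq> U"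
    proof
      fix f assume "f \<in> mball \<sigma> (1 / real (Suc n))"
      then have "cantor_dist \<sigma> f \<le> 1 / real (Suc n)" by (simp del: of_nat_Suc)
      then have eq: "\<sigma> k = f k" if "k < n" for k using that unfolding cantor_dist_le_iff by blast
      have "f k \<in> V k" for k
      proof (cases "k < n")
        case True
        then show ?thesis using V(2) by (simp add: PiE_iff flip: eq[OF True])
      next
        case False
        then have "V k = UNIV" using n[of k] by blast
        then show ?thesis by simp
      qed
      then have "f \<in> Pi\<^sub>E UNIV V" by (simp add: PiE_iff)
      then show "f \<in> U" using V(3) by auto
    qed
    then show ?thesis by (intro exI[of _ "1 / real (Suc n)"]) auto
  qed
  have "openin mtopology U \<longleftrightarrow> open U" for U
  proof
    assume "openin mtopology U"
    then show "open U"
      unfolding openin_mtopology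
      using 1 by (intro topological_space_class.openI) (meson UNIV_I centre_in_mball_iff)
  next
    assume "open U"
    then show "openin mtopology U" using 2 by (auto simp: openin_mtopology)
  qed
  then have "mtopology = euclidean" by (simp add: topology_eq)
  then show ?thesis by (simp add: mtopology_of_def)
qed

lemma cantor_dist_le_1: "cantor_dist \<sigma> \<tau> \<le> 1"
  using cantor_dist_le_iff[of \<sigma> \<tau> 0] by simp

lemma mspace_cantor_maps: "mspace cantor_maps = {f. continuous_on UNIV f}"
proof -
  interpret Metric_space UNIV cantor_dist by (rule Metric_space_cantor_dist)
  have "mbounded S" for S
    unfolding mbounded_alt using cantor_dist_le_1 by auto
  then show ?thesis
    by (auto simp: cantor_maps_def fspace_def)
qed

lemma mdist_cantor_maps:
  assumes "continuous_on UNIV f" "continuous_on UNIV g"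
  shows "mdist cantor_maps f g = (SUP \<sigma>. cantor_dist (f \<sigma>) (g \<sigma>))"
proof -
  interpret Metric_space UNIV cantor_dist by (rule Metric_space_cantor_dist)
  have "mbounded S" for S
    unfolding mbounded_alt using cantor_dist_le_1 by auto
  then show ?thesis
    by (simp add: cantor_maps_def cfunspace_def fdist_def fspace_def)
qed

lemma mdist_cantor_maps_upper:
  assumes "continuous_on UNIV f" "continuous_on UNIV g"
  shows "cantor_dist (f \<sigma>) (g \<sigma>) \<le> mdist cantor_maps f g"
  unfolding mdist_cantor_maps[OF assms]
  by (rule cSUP_upper) (auto intro!: bdd_aboveI2 cantor_dist_le_1)

lemma mdist_cantor_maps_attained:
  assumes "continuous_on UNIV f" "continuous_on UNIV g"
  shows "\<exists>\<sigma>. mdist cantor_maps f g = cantor_dist (f \<sigma>) (g \<sigma>)"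
proof (cases "f = g")
  case True
  then have "mdist cantor_maps f g = 0"
    using assms by (simp add: mspace_cantor_maps)
  then show ?thesis using True by (simp add: cantor_dist_def)
next
  case False
  define P where "P = (\<lambda>n. \<exists>\<sigma>. f \<sigma> n \<noteq> g \<sigma> n)"
  define n where "n = (LEAST n. P n)"
  have "\<exists>n. P n" using False by (auto simp: P_def fun_eq_iff)
  then have "P n" unfolding n_def by (rule LeastI_ex)
  then obtain \<sigma> where \<sigma>: "f \<sigma> n \<noteq> g \<sigma> n" by (auto simp: P_def)
  have eq: "f \<tau> k = g \<tau> k" if "k < n" for \<tau> k
    using that not_less_Least[of k P] by (auto simp: n_def P_def)
  have "(LEAST k. f \<sigma> k \<noteq> g \<sigma> k) = n"
    using \<sigma> eq by (intro Least_equality) (auto simp: not_less[symmetric])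
  then have d: "cantor_dist (f \<sigma>) (g \<sigma>) = 1 / real (Suc n)"
    using \<sigma> by (auto simp: cantor_dist_def)
  have "mdist cantor_maps f g \<le> 1 / real (Suc n)"
    unfolding mdist_cantor_maps[OF assms]
    by (rule cSUP_least) (use eq in \<open>auto simp: cantor_dist_le_iff simp del: of_nat_Suc\<close>)
  then have "mdist cantor_maps f g = cantor_dist (f \<sigma>) (g \<sigma>)"
    using d mdist_cantor_maps_upper[OF assms, of \<sigma>] by simp
  then show ?thesis by blast
qed

end

theory Submission
  imports Defs
begin

text \<open>
  A generic continuous self-map of Cantor space is equicontinuous, and equicontinuity excludes
  Li-Yorke pairs. Equicontinuity is used in the form of a condition that implies it: for infinitely
  many \<open>m\<close>, the first \<open>m\<close> coordinates of \<open>f x\<close> depend only on the first \<open>m\<close> coordinates of \<open>x\<close>.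
  For such an \<open>m\<close>, two orbits that once agree on the first \<open>m\<close> coordinates agree there forever;
  so orbits that come arbitrarily close to each other are asymptotic
  (\<open>no_Li_Yorke_pair_if_preserves_agreement\<close>).

  For a given \<open>n\<close>, the maps having such an \<open>m \<ge> n\<close> form an open set, because the condition for
  \<open>m\<close> mentions only the first \<open>m\<close> coordinates of the values of \<open>f\<close> and is therefore shared by
  all maps at distance at most \<open>1 / (m + 1)\<close>. They are dense: a continuous \<open>f\<close> is uniformly
  continuous, so for \<open>m\<close> large, erasing all coordinates from the \<open>m\<close>-th on, in the argument and
  in the value, leaves the first \<open>n\<close> coordinates of \<open>f x\<close> unchanged and yields a map with the
  property for \<open>m\<close> (\<open>preserves_agreement_approx\<close>). The intersection of these dense open sets
  over all \<open>n\<close> is comeager.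
\<close>

definition agree :: "nat \<Rightarrow> cantor \<Rightarrow> cantor \<Rightarrow> bool" where
  "agree n x y \<longleftrightarrow> (\<forall>k<n. x k = y k)"

lemma agree_mono: "agree m x y \<Longrightarrow> n \<le> m \<Longrightarrow> agree n x y"
  by (simp add: agree_def)

lemma agree_sym: "agree n x y \<Longrightarrow> agree n y x"
  by (simp add: agree_def)

lemma agree_trans: "agree n x y \<Longrightarrow> agree n y z \<Longrightarrow> agree n x z"
  by (simp add: agree_def)

lemma cantor_dist_le_iff_agree: "cantor_dist x y \<le> 1 / real (Suc n) \<longleftrightarrow> agree n x y"
  unfolding agree_def by (rule cantor_dist_le_iff)

definition preserves_agreement :: "nat \<Rightarrow> (cantor \<Rightarrow> cantor) \<Rightarrow> bool" where
  "preserves_agreement m f \<longleftrightarrow> (\<forall>x y. agree m x y \<longrightarrow> agree m (f x) (f y))"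

lemma preserves_agreement_funpow:
  assumes "preserves_agreement m f" "agree m x y"
  shows "agree m ((f ^^ k) x) ((f ^^ k) y)"
  by (induction k) (use assms in \<open>auto simp: preserves_agreement_def\<close>)

text \<open>
  A lower limit \<open>0\<close> makes the two orbits agree on \<open>m\<close> coordinates at some time, and the
  agreement then persists, which bounds the upper limit by \<open>1 / (n + 1)\<close> for each \<open>n\<close>.
\<close>

lemma no_Li_Yorke_pair_if_preserves_agreement:
  assumes f: "\<And>n. \<exists>m\<ge>n. preserves_agreement m f"
  shows "\<not> Li_Yorke_pair cantor_metric f x y"
proof
  define d where "d = (\<lambda>k. cantor_dist ((f ^^ k) x) ((f ^^ k) y))"
  assume "Li_Yorke_pair cantor_metric f x y"
  then have inf0: "liminf (\<lambda>k. ereal (d k)) = 0" and sup0: "limsup (\<lambda>k. ereal (d k)) > 0"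
    by (simp_all add: Li_Yorke_pair_def d_def)
  have bound: "limsup (\<lambda>k. ereal (d k)) \<le> ereal (1 / real (Suc n))" for n
  proof -
    obtain m where m: "m \<ge> n" "preserves_agreement m f" using f by blast
    have "liminf (\<lambda>k. ereal (d k)) < ereal (1 / real (Suc m))"
      using inf0 by simp
    moreover have "ereal (1 / real (Suc m)) \<le> liminf (\<lambda>k. ereal (d k))"
      if "\<forall>k. ereal (1 / real (Suc m)) \<le> ereal (d k)"
      by (rule Liminf_bounded) (rule always_eventually[OF that])
    ultimately have "\<not> (\<forall>k. ereal (1 / real (Suc m)) \<le> ereal (d k))"
      by (meson leD)
    then obtain k where "d k \<le> 1 / real (Suc m)"
      by (auto simp: not_le simp del: of_nat_Suc intro: less_imp_le)
    then have k: "agree m ((f ^^ k) x) ((f ^^ k) y)"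
      unfolding d_def by (simp only: cantor_dist_le_iff_agree)
    have "d j \<le> 1 / real (Suc n)" if "j \<ge> k" for j
    proof -
      have "agree m ((f ^^ (j - k)) ((f ^^ k) x)) ((f ^^ (j - k)) ((f ^^ k) y))"
        using m(2) k by (rule preserves_agreement_funpow)
      then have "agree m ((f ^^ j) x) ((f ^^ j) y)"
        using that by (metis comp_apply funpow_add le_add_diff_inverse2)
      then show ?thesis
        using m(1) agree_mono unfolding d_def cantor_dist_le_iff_agree by blast
    qed
    then show ?thesis
      by (intro Limsup_bounded eventually_sequentiallyI[of k]) (simp del: of_nat_Suc)
  qed
  have lim: "(\<lambda>n. ereal (1 / real (Suc n))) \<longlonglongrightarrow> ereal 0"
    by (intro tendsto_intros LIMSEQ_Suc lim_1_over_n)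
  have "limsup (\<lambda>k. ereal (d k)) \<le> ereal 0"
    by (rule LIMSEQ_le_const[OF lim]) (use bound in blast)
  with sup0 show False by (simp add: zero_ereal_def)
qed

lemma mdist_cantor_maps_le_iff_agree:
  assumes "continuous_on UNIV f" "continuous_on UNIV g"
  shows "mdist cantor_maps f g \<le> 1 / real (Suc n) \<longleftrightarrow> (\<forall>x. agree n (f x) (g x))"
proof -
  obtain z where "mdist cantor_maps f g = cantor_dist (f z) (g z)"
    using mdist_cantor_maps_attained[OF assms] by blast
  then show ?thesis
    using mdist_cantor_maps_upper[OF assms]
    by (metis cantor_dist_le_iff_agree order_trans)
qed

lemma preserves_agreement_near:
  assumes "preserves_agreement m f" "\<And>x. agree m (f x) (g x)"
  shows "preserves_agreement m g"
  using assms unfolding preserves_agreement_def by (meson agree_sym agree_trans)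

lemma compact_space_cantor: "compact_space (mtopology_of cantor_metric)"
proof -
  have "compact_space (product_topology (\<lambda>i::nat. euclidean :: bool topology) UNIV)"
    by (simp only: compact_space_product_topology)
      (simp add: compact_space_def finite_imp_compact)
  then show ?thesis by (simp add: euclidean_product_topology)
qed

text \<open>Uniform continuity on the compact Cantor space, read off in coordinates.\<close>

lemma continuous_imp_agree_modulus:
  assumes "continuous_on UNIV (f :: cantor \<Rightarrow> cantor)"
  shows "\<exists>m. \<forall>x y. agree m x y \<longrightarrow> agree n (f x) (f y)"
proof -
  have "continuous_map (mtopology_of cantor_metric) (mtopology_of cantor_metric) f"
    using assms by simp
  then have "uniformly_continuous_map cantor_metric cantor_metric f"
    using compact_space_cantor
    by (intro continuous_eq_uniformly_continuous_map[THEN iffD1])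
  then have "\<forall>\<epsilon>>0. \<exists>\<delta>>0. \<forall>x y. cantor_dist y x < \<delta> \<longrightarrow> cantor_dist (f y) (f x) < \<epsilon>"
    by (simp add: uniformly_continuous_map_def)
  moreover have "1 / real (Suc n) > 0" by simp
  ultimately obtain \<delta> where \<delta>: "\<delta> > 0"
    and d: "\<And>x y. cantor_dist y x < \<delta> \<Longrightarrow> cantor_dist (f y) (f x) < 1 / real (Suc n)"
    by blast
  obtain m where m: "1 / real (Suc m) < \<delta>" using nat_approx_posE[OF \<delta>] by blast
  have "agree n (f x) (f y)" if "agree m x y" for x y
  proof -
    have "cantor_dist x y < \<delta>"
      using that m order_le_less_trans unfolding cantor_dist_le_iff_agree[symmetric] by blast
    then show ?thesis
      using d less_imp_le unfolding cantor_dist_le_iff_agree[symmetric] by blast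
  qed
  then show ?thesis by blast
qed

definition truncate :: "nat \<Rightarrow> cantor \<Rightarrow> cantor" where
  "truncate m x = (\<lambda>k. k < m \<and> x k)"

lemma agree_truncate: "agree m (truncate m x) x"
  by (simp add: agree_def truncate_def)

lemma truncate_cong: "agree m x y \<Longrightarrow> truncate m x = truncate m y"
  by (auto simp: agree_def truncate_def)

lemma continuous_on_truncate: "continuous_on UNIV (truncate m)"
proof (rule continuous_on_coordinatewise_then_product)
  fix k show "continuous_on UNIV (\<lambda>x. truncate m x k)"
    by (cases "k < m") (auto simp: truncate_def)
qed

text \<open>
  The witness is \<open>f\<close> with argument and value truncated at a length \<open>m\<close> that is at least \<open>n\<close>
  and at least the modulus of \<open>f\<close> for \<open>n\<close>: truncating the argument does not affect the first \<open>n\<close>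
  coordinates of the value, by the choice of the modulus, and truncating the value does not
  because \<open>m \<ge> n\<close>.
\<close>

lemma preserves_agreement_approx:
  assumes "continuous_on UNIV f"
  shows "\<exists>g m. continuous_on UNIV g \<and> m \<ge> n \<and> preserves_agreement m g \<and> (\<forall>x. agree n (f x) (g x))"
proof -
  obtain m0 where m0: "\<And>x y. agree m0 x y \<Longrightarrow> agree n (f x) (f y)"
    using continuous_imp_agree_modulus[OF assms] by blast
  define m where "m = max m0 n"
  define g where "g = truncate m \<circ> f \<circ> truncate m"
  have "continuous_on UNIV g"
    unfolding g_def
    by (intro continuous_on_compose continuous_on_subset[OF assms]
        continuous_on_subset[OF continuous_on_truncate] subset_UNIV)
  moreover have "preserves_agreement m g"
    unfolding preserves_agreement_def
  proof (intro allI impI)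
    fix x y assume "agree m x y"
    then have "g x = g y" unfolding g_def comp_def by (simp only: truncate_cong)
    then show "agree m (g x) (g y)" by (simp add: agree_def)
  qed
  moreover have "agree n (f x) (g x)" for x
  proof -
    have "agree m x (truncate m x)" by (rule agree_sym) (rule agree_truncate)
    then have "agree n (f x) (f (truncate m x))"
      by (intro m0) (auto elim: agree_mono simp: m_def)
    moreover have "agree n (f (truncate m x)) (g x)"
      unfolding g_def comp_def
      by (rule agree_sym[OF agree_mono[OF agree_truncate]]) (simp add: m_def)
    ultimately show ?thesis by (rule agree_trans)
  qed
  ultimately show ?thesis by (intro exI[of _ g] exI[of _ m]) (auto simp: m_def)
qed

definition agreement_maps :: "nat \<Rightarrow> (cantor \<Rightarrow> cantor) set" where
  "agreement_maps n = {f. continuous_on UNIV f \<and> (\<exists>m\<ge>n. preserves_agreement m f)}"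

lemma openin_agreement_maps: "openin (mtopology_of cantor_maps) (agreement_maps n)"
proof -
  interpret C: Metric_space "mspace cantor_maps" "mdist cantor_maps" by simp
  show ?thesis
    unfolding mtopology_of_def C.openin_mtopology
  proof (intro conjI strip)
    show "agreement_maps n \<subseteq> mspace cantor_maps"
      by (auto simp: agreement_maps_def mspace_cantor_maps)
    fix f assume "f \<in> agreement_maps n"
    then obtain m where f: "continuous_on UNIV f" and m: "m \<ge> n" "preserves_agreement m f"
      by (auto simp: agreement_maps_def)
    have "C.mball f (1 / real (Suc m)) \<subseteq> agreement_maps n"
    proof
      fix g assume "g \<in> C.mball f (1 / real (Suc m))"
      then have g: "continuous_on UNIV g" and "mdist cantor_maps f g \<le> 1 / real (Suc m)"
        unfolding C.in_mball unfolding mspace_cantor_maps by (auto simp del: of_nat_Suc)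
      then have "preserves_agreement m g"
        using m(2) preserves_agreement_near mdist_cantor_maps_le_iff_agree[OF f g] by blast
      then show "g \<in> agreement_maps n" using g m(1) by (auto simp: agreement_maps_def)
    qed
    then show "\<exists>r>0. C.mball f r \<subseteq> agreement_maps n"
      by (intro exI[of _ "1 / real (Suc m)"]) auto
  qed
qed

text \<open>
  The approximation has to be accurate to \<open>max N n\<close> coordinates: \<open>N\<close> keeps it inside \<open>U\<close>, and
  \<open>n\<close> forces the length of the preserved agreement to be at least \<open>n\<close>.
\<close>

lemma agreement_maps_dense:
  assumes U: "openin (mtopology_of cantor_maps) U" "f \<in> U"
  shows "\<exists>g\<in>U. g \<in> agreement_maps n"
proof -
  interpret C: Metric_space "mspace cantor_maps" "mdist cantor_maps" by simp
  have f: "continuous_on UNIV f"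
    using openin_subset[OF U(1)] U(2) by (auto simp: mspace_cantor_maps)
  obtain r where r: "r > 0" "C.mball f r \<subseteq> U"
    using U unfolding mtopology_of_def C.openin_mtopology by blast
  obtain N where N: "1 / real (Suc N) < r" using nat_approx_posE[OF r(1)] by blast
  obtain g m where g: "continuous_on UNIV g" and m: "m \<ge> max N n" "preserves_agreement m g"
    and near: "\<And>x. agree (max N n) (f x) (g x)"
    using preserves_agreement_approx[OF f] by blast
  have "\<forall>x. agree N (f x) (g x)" using near agree_mono by (meson max.cobounded1)
  then have "mdist cantor_maps f g < r"
    using N mdist_cantor_maps_le_iff_agree[OF f g] by (meson order_le_less_trans)
  then have "g \<in> C.mball f r" using f g unfolding C.in_mball unfolding mspace_cantor_maps by simp
  then have "g \<in> U" using r(2) by blast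
  moreover have "g \<in> agreement_maps n" using g m by (auto simp: agreement_maps_def)
  ultimately show ?thesis by blast
qed

lemma comeager_in_INT_dense_open:
  assumes op: "\<And>n::nat. openin X (G n)"
    and dense: "\<And>n U x. openin X U \<Longrightarrow> x \<in> U \<Longrightarrow> \<exists>y\<in>U. y \<in> G n"
  shows "comeager_in X (\<Inter>n. G n)"
  unfolding comeager_in_def meager_in_def
proof (intro conjI exI[of _ "range (\<lambda>n. topspace X - G n)"] ballI)
  show "(\<Inter>n. G n) \<subseteq> topspace X" using openin_subset[OF op] by blast
  fix N assume "N \<in> range (\<lambda>n. topspace X - G n)"
  then obtain n where N: "N = topspace X - G n" by blast
  then have "X closure_of N = N" using op by (simp add: closure_of_closedin closedin_diff)
  moreover have "X interior_of N = {}"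
    unfolding interior_of_def N using dense[of _ _ n] by blast
  ultimately show "nowhere_dense_in X N" by (simp add: nowhere_dense_in_def N)
qed auto

theorem theorem5p2:
  shows "\<exists>\<R>. comeager_in (mtopology_of cantor_maps) \<R> \<and>
           (\<forall>f\<in>\<R>. \<not> (\<exists>x y. Li_Yorke_pair cantor_metric f x y))"
proof (intro exI conjI ballI)
  show "comeager_in (mtopology_of cantor_maps) (\<Inter>n. agreement_maps n)"
    by (intro comeager_in_INT_dense_open openin_agreement_maps agreement_maps_dense)
  fix f assume "f \<in> (\<Inter>n. agreement_maps n)"
  then have "\<exists>m\<ge>n. preserves_agreement m f" for n by (auto simp: agreement_maps_def)
  then show "\<not> (\<exists>x y. Li_Yorke_pair cantor_metric f x y)"
    using no_Li_Yorke_pair_if_preserves_agreement by blast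
qed

end
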